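(* There exists a Hausdorff, non-regular, Baire pseudo $P$-space which is not hereditarily weakly Volterra, i.e. which has a subspace that is not weakly Volterra.
   Context: A subset of a topological space is a $G_\delta$ set if it is a countable intersection of open sets. A topological space $X$ is an almost $P$-space if every non-empty $G_\delta$ subset of $X$ has non-empty interior; it is a weak $P$-space if every countable subset of $X$ is closed (and hence discrete); it is a pseudo $P$-space if it is both an almost $P$-space and a weak $P$-space. A space is Baire if every countable intersection of dense open subsets is dense. A space $Y$ is weakly Volterra if for every pair $G, H$ of dense $G_\delta$ subsets of $Y$, the set $G \cap H$ is non-empty. A space is hereditarily weakly Volterra if each of its (non-empty) subspaces, with the subspace topology, is weakly Volterra. All spaces and subspaces are understood to be non-empty. *)

theory Defs
  imports "HOL-Analysis.Analysis"
begin

definition dense_in :: "'a topology \<Rightarrow> 'a set \<Rightarrow> bool" where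
  "dense_in X S \<longleftrightarrow> S \<subseteq> topspace X \<and> X closure_of S = topspace X"

definition almost_P_space :: "'a topology \<Rightarrow> bool" where
  "almost_P_space X \<longleftrightarrow> (\<forall>S. gdelta_in X S \<and> S \<noteq> {} \<longrightarrow> X interior_of S \<noteq> {})"

definition weak_P_space :: "'a topology \<Rightarrow> bool" where
  "weak_P_space X \<longleftrightarrow> (\<forall>C. C \<subseteq> topspace X \<and> countable C \<longrightarrow> closedin X C)"

definition pseudo_P_space :: "'a topology \<Rightarrow> bool" where
  "pseudo_P_space X \<longleftrightarrow> almost_P_space X \<and> weak_P_space X"

(* Intersecting with the carrier makes the empty family contribute topspace X
   rather than UNIV. *)
definition Baire_space :: "'a topology \<Rightarrow> bool" where
  "Baire_space X \<longleftrightarrow>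
     (\<forall>\<U>. countable \<U> \<and> (\<forall>U\<in>\<U>. openin X U \<and> dense_in X U)
        \<longrightarrow> dense_in X (topspace X \<inter> \<Inter>\<U>))"

definition weakly_Volterra_space :: "'a topology \<Rightarrow> bool" where
  "weakly_Volterra_space Y \<longleftrightarrow>
     (\<forall>G H. gdelta_in Y G \<and> dense_in Y G \<and> gdelta_in Y H \<and> dense_in Y H
        \<longrightarrow> G \<inter> H \<noteq> {})"

(* The empty subspace must be excluded: it is never weakly Volterra. *)
definition hereditarily_weakly_Volterra_space :: "'a topology \<Rightarrow> bool" where
  "hereditarily_weakly_Volterra_space X \<longleftrightarrow>
     (\<forall>S. S \<subseteq> topspace X \<and> S \<noteq> {} \<longrightarrow> weakly_Volterra_space (subtopology X S))"

end

theory Submission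
  imports Defs
begin

text \<open>
  The example is assembled from two independent constructions.

  The first handles everything except Baire and almost P.  Split a countable subset of the line
  into two disjoint dense parts \<open>A\<close> and \<open>B\<close>, and refine the Euclidean topology on
  \<open>(A \<union> B) \<times> \<real>\<close> by declaring countable sets closed.  The vertical lines are closed, so
  \<open>A \<times> \<real>\<close> and \<open>B \<times> \<real>\<close>, each the complement of countably many of them, are disjoint
  \<open>G\<^sub>\<delta>\<close> sets (\<open>gdelta_in_strip\<close>).  Both meet every Euclidean open set in uncountably many
  points, hence remain dense in the refinement (\<open>dense_in_cocountable_refinement\<close>), so the space is
  not weakly Volterra.  Regularity fails for the same reason: a countable Euclidean-dense set has
  become closed, yet cannot be separated from any point outside it
  (\<open>not_regular_space_cocountable_refinement\<close>).

  The second construction repairs Baire and almost P.  Attach to every point \<open>p\<close> of a space an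
  uncountable cloud of isolated points, and require a neighbourhood of \<open>p\<close> to contain
  all but countably many points of its cloud, and of the cloud of each old point near \<open>p\<close>.
  Countably many neighbourhoods of \<open>p\<close> then share cloud points, so every nonempty \<open>G\<^sub>\<delta>\<close>
  set contains an isolated point; and since the isolated points are dense, the space is Baire.
  The Hausdorff and weak P properties are inherited, and the old space sits inside as a closed
  subspace, so the extension is not regular either and has a subspace that is not weakly Volterra.

  Since \<open>(\<real> \<times> \<real>) \<times> \<real>\<close> has the cardinality of \<open>\<real>\<close>, the result can be moved to the type of
  reals along a bijection.
\<close>

section \<open>Topological preliminaries\<close>

lemma dense_in_iff_meets_open:
  "dense_in X S \<longleftrightarrow>
     S \<subseteq> topspace X \<and> (\<forall>U. openin X U \<and> U \<noteq> {} \<longrightarrow> S \<inter> U \<noteq> {})"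
  unfolding dense_in_def using dense_intersects_open[of X S] by blast

lemma gdelta_in_nbhds:
  assumes "gdelta_in X S"
  obtains \<U> where "countable \<U>" "\<And>U. U \<in> \<U> \<Longrightarrow> openin X U" "S = topspace X \<inter> \<Inter>\<U>"
proof -
  obtain \<U> where "countable \<U>" "\<U> \<subseteq> Collect (openin X)" "topspace X \<inter> \<Inter>\<U> = S"
    using assms unfolding gdelta_in_def relative_to_def intersection_of_def by auto
  then show ?thesis
    using that[of \<U>] by auto
qed

lemma homeomorphic_map_dense_in:
  assumes "homeomorphic_map X Y f" "S \<subseteq> topspace X"
  shows "dense_in Y (f ` S) \<longleftrightarrow> dense_in X S"
proof -
  have inj: "inj_on f (topspace X)" and im: "f ` topspace X = topspace Y"
    using assms(1) by (auto simp: homeomorphic_eq_everything_map)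
  have "Y closure_of (f ` S) = f ` (X closure_of S)"
    using homeomorphic_map_closure_of[OF assms] .
  then have "Y closure_of (f ` S) = topspace Y \<longleftrightarrow> X closure_of S = topspace X"
    using inj_on_image_eq_iff[OF inj closure_of_subset_topspace order_refl] im by metis
  then show ?thesis
    unfolding dense_in_def using assms(2) im by blast
qed

lemma homeomorphic_map_weakly_Volterra_space:
  assumes f: "homeomorphic_map X Y f" and "weakly_Volterra_space Y"
  shows "weakly_Volterra_space X"
  unfolding weakly_Volterra_space_def
proof (intro allI impI)
  fix G H
  assume *: "gdelta_in X G \<and> dense_in X G \<and> gdelta_in X H \<and> dense_in X H"
  then have sub: "G \<subseteq> topspace X" "H \<subseteq> topspace X"
    by (auto simp: dense_in_def)
  have "gdelta_in Y (f ` G) \<and> dense_in Y (f ` G) \<and> gdelta_in Y (f ` H) \<and> dense_in Y (f ` H)"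
    using * sub homeomorphic_map_dense_in[OF f] homeomorphic_map_gdeltaness[OF f] by blast
  then have "f ` G \<inter> f ` H \<noteq> {}"
    using assms(2) unfolding weakly_Volterra_space_def by blast
  moreover have "inj_on f (topspace X)"
    using f by (simp add: homeomorphic_eq_everything_map)
  ultimately show "G \<inter> H \<noteq> {}"
    using sub by (metis image_empty inj_on_image_Int)
qed

lemma homeomorphic_map_Baire_space:
  assumes f: "homeomorphic_map X Y f" and "Baire_space X"
  shows "Baire_space Y"
  unfolding Baire_space_def
proof (intro allI impI)
  fix \<V> assume \<V>: "countable \<V> \<and> (\<forall>V\<in>\<V>. openin Y V \<and> dense_in Y V)"
  have im: "f ` topspace X = topspace Y"
    using f by (simp add: homeomorphic_eq_everything_map)
  define pre where "pre V = {x \<in> topspace X. f x \<in> V}" for V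
  have pre: "pre V \<subseteq> topspace X" "openin Y V \<Longrightarrow> f ` pre V = V" for V
    using im openin_subset[of Y V] by (auto simp: pre_def)
  have "openin X (pre V) \<and> dense_in X (pre V)" if "V \<in> \<V>" for V
    using \<V> that pre homeomorphic_map_openness[OF f] homeomorphic_map_dense_in[OF f] by metis
  then have "dense_in X (topspace X \<inter> \<Inter>(pre ` \<V>))"
    using assms(2) \<V> unfolding Baire_space_def by blast
  moreover have "f ` (topspace X \<inter> \<Inter>(pre ` \<V>)) = topspace Y \<inter> \<Inter>\<V>"
  proof
    show "topspace Y \<inter> \<Inter>\<V> \<subseteq> f ` (topspace X \<inter> \<Inter>(pre ` \<V>))"
    proof
      fix y assume y: "y \<in> topspace Y \<inter> \<Inter>\<V>"
      then obtain x where "x \<in> topspace X" "y = f x"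
        using im by blast
      then show "y \<in> f ` (topspace X \<inter> \<Inter>(pre ` \<V>))"
        using y by (auto simp: pre_def)
    qed
  qed (use im in \<open>auto simp: pre_def\<close>)
  ultimately show "dense_in Y (topspace Y \<inter> \<Inter>\<V>)"
    using homeomorphic_map_dense_in[OF f, of "topspace X \<inter> \<Inter>(pre ` \<V>)"] by auto
qed

lemma homeomorphic_map_pseudo_P_space:
  assumes f: "homeomorphic_map X Y f" and "pseudo_P_space X"
  shows "pseudo_P_space Y"
proof -
  have im: "f ` topspace X = topspace Y"
    using f by (simp add: homeomorphic_eq_everything_map)
  have "Y interior_of S \<noteq> {}" if S: "gdelta_in Y S" "S \<noteq> {}" for S
  proof -
    obtain R where R: "R \<subseteq> topspace X" "f ` R = S"
      using gdelta_in_subset[OF S(1)] im by (metis subset_image_iff)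
    then have "gdelta_in X R" "R \<noteq> {}"
      using S homeomorphic_map_gdeltaness[OF f] by auto
    then have "X interior_of R \<noteq> {}"
      using assms(2) unfolding pseudo_P_space_def almost_P_space_def by blast
    then show ?thesis
      using homeomorphic_map_interior_of[OF f R(1)] R(2) by auto
  qed
  moreover have "closedin Y C" if C: "C \<subseteq> topspace Y" "countable C" for C
  proof -
    obtain B where B: "B \<subseteq> topspace X" "countable B" "f ` B = C"
      using C im by (metis countable_subset_image)
    then show ?thesis
      using assms(2) homeomorphic_map_closedness[OF f]
      unfolding pseudo_P_space_def weak_P_space_def by auto
  qed
  ultimately show ?thesis
    unfolding pseudo_P_space_def almost_P_space_def weak_P_space_def by blast
qed

lemma homeomorphic_map_pullback:
  assumes "bij g"
  shows "homeomorphic_map (pullback_topology UNIV g X) X g"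
  unfolding homeomorphic_eq_everything_map
proof (intro conjI)
  show "g ` topspace (pullback_topology UNIV g X) = topspace X"
    using bij_is_surj[OF assms] by (simp add: topspace_pullback_topology)
  show "inj_on g (topspace (pullback_topology UNIV g X))"
    using bij_is_inj[OF assms] inj_on_subset by blast
  show "continuous_map (pullback_topology UNIV g X) X g"
    by (metis comp_id continuous_map_id continuous_map_pullback id_comp)
  show om: "open_map (pullback_topology UNIV g X) X g"
    unfolding open_map_def openin_pullback_topology
    using bij_is_surj[OF assms] by (auto simp: surj_image_vimage_eq)
  show "closed_map (pullback_topology UNIV g X) X g"
    using om \<open>inj_on g _\<close> \<open>g ` _ = _\<close>
    by (metis bijective_open_imp_closed_map)
qed

section \<open>Removing countable sets from open sets\<close>

text \<open>Stating the condition through neighbourhoods, instead of generating the topology from the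
  differences of open and countable sets, makes each open set comparable with a single \<open>T\<close>-open
  set at each of its points, which is the form in which density arguments use it.\<close>

definition cocountable_refinement :: "'a topology \<Rightarrow> 'a topology" where
  "cocountable_refinement T = topology (\<lambda>S. S \<subseteq> topspace T \<and>
     (\<forall>p\<in>S. \<exists>U. openin T U \<and> p \<in> U \<and> countable (U - S)))"

lemma openin_cocountable_refinement:
  "openin (cocountable_refinement T) S \<longleftrightarrow>
     S \<subseteq> topspace T \<and> (\<forall>p\<in>S. \<exists>U. openin T U \<and> p \<in> U \<and> countable (U - S))"
proof -
  have "istopology (\<lambda>S. S \<subseteq> topspace T \<and>
     (\<forall>p\<in>S. \<exists>U. openin T U \<and> p \<in> U \<and> countable (U - S)))" (is "istopology ?O")
    unfolding istopology_def
  proof (rule conjI; intro allI impI)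
    fix S S' assume S: "?O S" "?O S'"
    have "\<exists>U. openin T U \<and> p \<in> U \<and> countable (U - S \<inter> S')" if p: "p \<in> S \<inter> S'" for p
    proof -
      obtain U where "openin T U" "p \<in> U" "countable (U - S)"
        using S(1) p by auto
      moreover obtain U' where "openin T U'" "p \<in> U'" "countable (U' - S')"
        using S(2) p by auto
      moreover have "U \<inter> U' - S \<inter> S' \<subseteq> (U - S) \<union> (U' - S')"
        by blast
      ultimately have "openin T (U \<inter> U') \<and> p \<in> U \<inter> U' \<and> countable (U \<inter> U' - S \<inter> S')"
        by (meson IntI countable_Un countable_subset openin_Int)
      then show ?thesis by blast
    qed
    then show "?O (S \<inter> S')" using S by (simp add: le_infI1)
  next
    fix \<K> assume K: "\<forall>K\<in>\<K>. ?O K"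
    have "\<exists>U. openin T U \<and> p \<in> U \<and> countable (U - \<Union>\<K>)" if p: "p \<in> \<Union>\<K>" for p
    proof -
      obtain S where S: "S \<in> \<K>" "p \<in> S"
        using p by blast
      then obtain U where "openin T U" "p \<in> U" "countable (U - S)"
        using K by meson
      moreover have "U - \<Union>\<K> \<subseteq> U - S"
        using S by blast
      ultimately show ?thesis by (meson countable_subset)
    qed
    then show "?O (\<Union>\<K>)" using K by (simp add: Sup_le_iff)
  qed
  then show ?thesis
    by (simp add: cocountable_refinement_def)
qed

lemma cocountable_refinement_nbhd:
  assumes "openin (cocountable_refinement T) W" "p \<in> W"
  obtains U where "openin T U" "p \<in> U" "countable (U - W)"
  using assms by (auto simp: openin_cocountable_refinement)

lemma openin_cocountable_refinement_diff:
  assumes "openin T U" "countable C"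
  shows "openin (cocountable_refinement T) (U - C)"
proof -
  have "countable (U - (U - C))"
    using assms(2) by (rule countable_subset[rotated]) auto
  then have "\<exists>V. openin T V \<and> p \<in> V \<and> countable (V - (U - C))" if "p \<in> U - C" for p
    using assms(1) that by (intro exI[of _ U]) auto
  moreover have "U - C \<subseteq> topspace T"
    using openin_subset[OF assms(1)] by blast
  ultimately show ?thesis
    by (simp add: openin_cocountable_refinement)
qed

lemma openin_imp_openin_cocountable_refinement:
  "openin T U \<Longrightarrow> openin (cocountable_refinement T) U"
  using openin_cocountable_refinement_diff[of T U "{}"] by simp

lemma topspace_cocountable_refinement [simp]:
  "topspace (cocountable_refinement T) = topspace T"
proof
  show "topspace (cocountable_refinement T) \<subseteq> topspace T"
    using openin_topspace[of "cocountable_refinement T"]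
    by (simp only: openin_cocountable_refinement)
  show "topspace T \<subseteq> topspace (cocountable_refinement T)"
    by (intro openin_subset openin_imp_openin_cocountable_refinement openin_topspace)
qed

lemma Hausdorff_space_cocountable_refinement:
  assumes "Hausdorff_space T"
  shows "Hausdorff_space (cocountable_refinement T)"
  unfolding Hausdorff_space_def topspace_cocountable_refinement
proof (intro allI impI)
  fix x y assume "x \<in> topspace T \<and> y \<in> topspace T \<and> x \<noteq> y"
  then obtain U V where "openin T U" "openin T V" "x \<in> U" "y \<in> V" "disjnt U V"
    using assms unfolding Hausdorff_space_def by meson
  then show "\<exists>U V. openin (cocountable_refinement T) U \<and> openin (cocountable_refinement T) V \<and>
      x \<in> U \<and> y \<in> V \<and> disjnt U V"
    by (intro exI[of _ U] exI[of _ V]) (simp add: openin_imp_openin_cocountable_refinement)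
qed

lemma weak_P_space_cocountable_refinement: "weak_P_space (cocountable_refinement T)"
  by (simp add: weak_P_space_def closedin_def openin_cocountable_refinement_diff)

lemma dense_in_cocountable_refinement:
  assumes "S \<subseteq> topspace T"
    and "\<And>U. openin T U \<Longrightarrow> U \<noteq> {} \<Longrightarrow> uncountable (S \<inter> U)"
  shows "dense_in (cocountable_refinement T) S"
  unfolding dense_in_iff_meets_open
proof (intro conjI allI impI)
  fix W assume "openin (cocountable_refinement T) W \<and> W \<noteq> {}"
  then obtain U where "openin T U" "U \<noteq> {}" "countable (U - W)"
    unfolding openin_cocountable_refinement by blast
  then have "\<not> S \<inter> U \<subseteq> U - W"
    using assms(2) countable_subset by blast
  then show "S \<inter> W \<noteq> {}" by blast
qed (use assms in simp)

text \<open>A countable dense set \<open>D\<close> is closed in the refinement.  Open sets of the refinement that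
  contain a point \<open>a\<close> and the whole of \<open>D\<close> respectively are, up to countable sets, open sets \<open>U\<close>
  around \<open>a\<close> and \<open>U'\<close> around some \<open>d \<in> D \<inter> U\<close>.  As \<open>U \<inter> U'\<close> is uncountable, deleting countably
  many points cannot make them disjoint.\<close>

lemma not_regular_space_cocountable_refinement:
  assumes unc: "\<And>U. openin T U \<Longrightarrow> U \<noteq> {} \<Longrightarrow> uncountable U"
    and D: "countable D" "dense_in T D" and "topspace T \<noteq> {}"
  shows "\<not> regular_space (cocountable_refinement T)"
proof
  let ?R = "cocountable_refinement T"
  assume reg: "regular_space ?R"
  have "uncountable (topspace T)"
    using unc[OF openin_topspace assms(4)] .
  then have "\<not> topspace T \<subseteq> D"
    using D(1) by (meson countable_subset)
  then obtain a where a: "a \<in> topspace T" "a \<notin> D"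
    by blast
  have "D \<subseteq> topspace ?R"
    using D(2) by (simp add: dense_in_def)
  then have "closedin ?R D"
    using weak_P_space_cocountable_refinement D(1) unfolding weak_P_space_def by blast
  moreover have "a \<in> topspace ?R - D"
    using a by simp
  ultimately obtain V W where VW: "openin ?R V" "openin ?R W" "a \<in> V" "D \<subseteq> W" "disjnt V W"
    using reg unfolding regular_space_def by meson
  obtain U where U: "openin T U" "a \<in> U" "countable (U - V)"
    using cocountable_refinement_nbhd[OF VW(1,3)] .
  obtain d where d: "d \<in> D" "d \<in> U"
    using D(2) U unfolding dense_in_iff_meets_open by blast
  obtain U' where U': "openin T U'" "d \<in> U'" "countable (U' - W)"
    using cocountable_refinement_nbhd[OF VW(2)] VW(4) d(1) by blast
  have "U \<inter> U' \<subseteq> (U - V) \<union> (U' - W)"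
    using VW(5) by (auto simp: disjnt_def)
  then have "countable (U \<inter> U')"
    using U(3) U'(3) by (meson countable_Un countable_subset)
  moreover have "openin T (U \<inter> U')" "U \<inter> U' \<noteq> {}"
    using U(1) U'(1,2) d(2) by auto
  ultimately show False
    using unc by meson
qed

section \<open>Attaching clouds of isolated points\<close>

text \<open>The point \<open>(p, 0)\<close> stands for the old point \<open>p\<close>, and the \<open>(p, t)\<close> with \<open>t \<noteq> 0\<close> form its
  cloud.\<close>

definition cloud_extension :: "'a topology \<Rightarrow> ('a \<times> real) topology" where
  "cloud_extension T = topology (\<lambda>W. W \<subseteq> topspace T \<times> UNIV \<and> openin T {p. (p, 0) \<in> W} \<and>
     (\<forall>p. (p, 0) \<in> W \<longrightarrow> countable {t. (p, t) \<notin> W}))"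

lemma openin_cloud_extension:
  "openin (cloud_extension T) W \<longleftrightarrow>
     W \<subseteq> topspace T \<times> UNIV \<and> openin T {p. (p, 0) \<in> W} \<and>
     (\<forall>p. (p, 0) \<in> W \<longrightarrow> countable {t. (p, t) \<notin> W})"
proof -
  have "istopology (\<lambda>W. W \<subseteq> topspace T \<times> UNIV \<and> openin T {p. (p, 0) \<in> W} \<and>
     (\<forall>p. (p, 0) \<in> W \<longrightarrow> countable {t::real. (p, t) \<notin> W}))" (is "istopology ?O")
    unfolding istopology_def
  proof (rule conjI; intro allI impI)
    fix V W assume VW: "?O V" "?O W"
    have "{p. (p, 0) \<in> V \<inter> W} = {p. (p, 0) \<in> V} \<inter> {p. (p, 0) \<in> W}"
      by blast
    then have "openin T {p. (p, 0) \<in> V \<inter> W}"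
      using VW by (metis (no_types, lifting) openin_Int)
    moreover have "countable {t. (p, t) \<notin> V \<inter> W}" if "(p, 0) \<in> V \<inter> W" for p
    proof -
      have "{t. (p, t) \<notin> V \<inter> W} = {t. (p, t) \<notin> V} \<union> {t. (p, t) \<notin> W}"
        by blast
      then show ?thesis using VW that by auto
    qed
    ultimately show "?O (V \<inter> W)" using VW by blast
  next
    fix \<K> assume K: "\<forall>K\<in>\<K>. ?O K"
    have "{p. (p, 0) \<in> \<Union>\<K>} = (\<Union>W\<in>\<K>. {p. (p, 0) \<in> W})"
      by blast
    moreover have "openin T (\<Union>W\<in>\<K>. {p. (p, 0) \<in> W})"
      using K by (intro openin_Union) blast
    ultimately have "openin T {p. (p, 0) \<in> \<Union>\<K>}"
      by simp
    moreover have "countable {t. (p, t) \<notin> \<Union>\<K>}" if p: "(p, 0) \<in> \<Union>\<K>" for p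
    proof -
      obtain W where "W \<in> \<K>" "(p, 0) \<in> W" using p by blast
      then have "countable {t. (p, t) \<notin> W}" "{t. (p, t) \<notin> \<Union>\<K>} \<subseteq> {t. (p, t) \<notin> W}"
        using K by blast+
      then show ?thesis using countable_subset by blast
    qed
    ultimately show "?O (\<Union>\<K>)" using K by blast
  qed
  then show ?thesis
    by (simp add: cloud_extension_def)
qed

lemma topspace_cloud_extension [simp]:
  "topspace (cloud_extension T) = topspace T \<times> UNIV"
proof
  show "topspace (cloud_extension T) \<subseteq> topspace T \<times> UNIV"
    using openin_topspace[of "cloud_extension T"] by (simp only: openin_cloud_extension)
  show "topspace T \<times> UNIV \<subseteq> topspace (cloud_extension T)"
    by (intro openin_subset) (simp add: openin_cloud_extension)
qed

lemma openin_cloud_extension_isolated: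
  assumes "W \<subseteq> topspace T \<times> - {0}"
  shows "openin (cloud_extension T) W"
proof -
  have "{p. (p, 0) \<in> W} = {}"
    using assms by auto
  then show ?thesis
    using assms unfolding openin_cloud_extension by auto
qed

lemma openin_cloud_extension_cylinder:
  assumes "openin T U"
  shows "openin (cloud_extension T) (U \<times> UNIV)"
  using assms openin_subset[OF assms] by (auto simp: openin_cloud_extension)

text \<open>Every dense set contains all isolated points, and the isolated points alone are dense.\<close>

lemma Baire_space_cloud_extension: "Baire_space (cloud_extension T)"
proof -
  let ?X = "cloud_extension T" and ?D = "topspace T \<times> - {0::real}"
  have D: "?D \<subseteq> U" if "dense_in ?X U" for U
  proof
    fix d assume "d \<in> ?D"
    then have "openin ?X {d}"
      by (intro openin_cloud_extension_isolated) auto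
    then show "d \<in> U"
      using that unfolding dense_in_iff_meets_open by blast
  qed
  have "?D \<inter> W \<noteq> {}" if W: "openin ?X W" "W \<noteq> {}" for W
  proof -
    obtain p t where pt: "(p, t) \<in> W" "p \<in> topspace T"
      using W openin_subset[OF W(1)] by auto
    show ?thesis
    proof (cases "t = 0")
      case True
      then have "countable (insert 0 {t. (p, t) \<notin> W})"
        using W pt by (simp add: openin_cloud_extension)
      then obtain s where "s \<notin> insert 0 {t. (p, t) \<notin> W}"
        by (metis UNIV_I countable_subset subsetI uncountable_UNIV_real)
      then show ?thesis using pt by auto
    qed (use pt in auto)
  qed
  then have dense: "dense_in ?X S" if "?D \<subseteq> S" "S \<subseteq> topspace ?X" for S
    using that unfolding dense_in_iff_meets_open by blast
  show ?thesis
    unfolding Baire_space_def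
  proof (intro allI impI dense)
    fix \<U> assume "countable \<U> \<and> (\<forall>U\<in>\<U>. openin ?X U \<and> dense_in ?X U)"
    then have "?D \<subseteq> \<Inter>\<U>"
      using D by (meson Inter_greatest)
    moreover have "?D \<subseteq> topspace ?X"
      by auto
    ultimately show "?D \<subseteq> topspace ?X \<inter> \<Inter>\<U>"
      by blast
  qed auto
qed

text \<open>Countably many neighbourhoods of \<open>(p, 0)\<close> omit only countably many points of the cloud of
  \<open>p\<close>, so their intersection contains an isolated point.\<close>

lemma almost_P_space_cloud_extension: "almost_P_space (cloud_extension T)"
  unfolding almost_P_space_def
proof (intro allI impI)
  let ?X = "cloud_extension T"
  fix S assume "gdelta_in ?X S \<and> S \<noteq> {}"
  then obtain \<U> p t where \<U>: "countable \<U>" "\<And>U. U \<in> \<U> \<Longrightarrow> openin ?X U"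
    "S = topspace ?X \<inter> \<Inter>\<U>" and pt: "(p, t) \<in> S"
    by (metis ex_in_conv gdelta_in_nbhds surj_pair)
  obtain s where s: "s \<noteq> 0" "(p, s) \<in> S"
  proof (cases "t = 0")
    case True
    have "countable {t. (p, t) \<notin> U}" if "U \<in> \<U>" for U
      using \<U> pt True that by (auto simp: openin_cloud_extension)
    then have "countable (insert 0 (\<Union>U\<in>\<U>. {t. (p, t) \<notin> U}))"
      using \<U>(1) by simp
    then obtain s where "s \<notin> insert 0 (\<Union>U\<in>\<U>. {t. (p, t) \<notin> U})"
      by (metis UNIV_I countable_subset subsetI uncountable_UNIV_real)
    then have "s \<noteq> 0" "(p, s) \<in> S"
      using \<U>(3) pt by auto
    then show ?thesis by (rule that)
  qed (use pt that in blast)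
  have "openin ?X {(p, s)}"
    using s \<U>(3) by (intro openin_cloud_extension_isolated) auto
  then have "(p, s) \<in> ?X interior_of S"
    using s(2) unfolding interior_of_def by blast
  then show "?X interior_of S \<noteq> {}" by blast
qed

lemma weak_P_space_cloud_extension:
  assumes "weak_P_space T"
  shows "weak_P_space (cloud_extension T)"
  unfolding weak_P_space_def
proof (intro allI impI)
  fix C assume C: "C \<subseteq> topspace (cloud_extension T) \<and> countable C"
  let ?W = "topspace T \<times> UNIV - C" and ?C0 = "{p \<in> fst ` C. (p, 0) \<in> C}"
  have "countable ?C0" "?C0 \<subseteq> topspace T"
    using C countable_subset[of ?C0 "fst ` C"] by auto
  then have "closedin T ?C0"
    using assms unfolding weak_P_space_def by blast
  then have "openin T (topspace T - ?C0)"
    by blast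
  moreover have "{p. (p, 0) \<in> ?W} = topspace T - ?C0"
    by force
  moreover have "countable {t. (p, t) \<notin> ?W}" if "(p, 0) \<in> ?W" for p
  proof -
    have "{t. (p, t) \<notin> ?W} \<subseteq> snd ` C"
      using that by force
    then show ?thesis
      using C by (meson countable_image countable_subset)
  qed
  ultimately have "openin (cloud_extension T) ?W"
    unfolding openin_cloud_extension by auto
  then show "closedin (cloud_extension T) C"
    using C by (simp add: closedin_def)
qed

text \<open>Open cylinders separate points over distinct base points.  Over a single base point one of the
  two points is isolated, and its complement is open since it misses one point of one cloud.\<close>

lemma Hausdorff_space_cloud_extension:
  assumes "Hausdorff_space T"
  shows "Hausdorff_space (cloud_extension T)"
proof -
  let ?X = "cloud_extension T"
  have iso: "\<exists>U V. openin ?X U \<and> openin ?X V \<and> (p, t) \<in> U \<and> (q, s) \<in> V \<and> disjnt U V"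
    if "p \<in> topspace T" "q \<in> topspace T" "t \<noteq> 0" "(p, t) \<noteq> (q, s)" for p q t s
  proof (intro exI conjI)
    show "openin ?X {(p, t)}"
      using that by (intro openin_cloud_extension_isolated) auto
    have "countable {r. (x, r) \<notin> topspace T \<times> UNIV - {(p, t)}}" if "x \<in> topspace T" for x
      by (rule countable_subset[of _ "{t}"]) (use that in auto)
    moreover have "{x. (x, 0) \<in> topspace T \<times> UNIV - {(p, t)}} = topspace T"
      using that by auto
    ultimately show "openin ?X (topspace T \<times> UNIV - {(p, t)})"
      by (auto simp: openin_cloud_extension)
  qed (use that in auto)
  have sep: "\<exists>U V. openin ?X U \<and> openin ?X V \<and> (p, t) \<in> U \<and> (q, s) \<in> V \<and> disjnt U V"
    if pq: "p \<in> topspace T" "q \<in> topspace T" "p \<noteq> q" for p q t s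
  proof -
    obtain U V where "openin T U" "openin T V" "p \<in> U" "q \<in> V" "disjnt U V"
      using assms pq unfolding Hausdorff_space_def by meson
    then show ?thesis
      by (intro exI[of _ "U \<times> UNIV"] exI[of _ "V \<times> UNIV"])
        (auto simp: openin_cloud_extension_cylinder disjnt_def)
  qed
  have "\<exists>U V. openin ?X U \<and> openin ?X V \<and> (p, t) \<in> U \<and> (q, s) \<in> V \<and> disjnt U V"
    if pq: "p \<in> topspace T" "q \<in> topspace T" "(p, t) \<noteq> (q, s)" for p q t s
  proof -
    consider "t \<noteq> 0" | "s \<noteq> 0" | "p \<noteq> q" using pq by auto
    then show ?thesis
    proof cases
      case 1
      then show ?thesis using iso[OF pq(1,2) _ pq(3)] by simp
    next
      case 2
      then obtain V U where "openin ?X V" "openin ?X U" "(q, s) \<in> V" "(p, t) \<in> U" "disjnt V U"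
        using iso[OF pq(2,1) _ pq(3)[symmetric]] by blast
      then show ?thesis using disjnt_sym by blast
    next
      case 3
      then show ?thesis using sep pq(1,2) by simp
    qed
  qed
  then show ?thesis
    unfolding Hausdorff_space_def topspace_cloud_extension by (auto simp: mem_Times_iff)
qed

lemma embedding_map_cloud_extension:
  "embedding_map T (cloud_extension T) (\<lambda>p. (p, 0))"
proof (rule injective_closed_imp_embedding_map)
  let ?X = "cloud_extension T"
  show "continuous_map T ?X (\<lambda>p. (p, 0))"
    unfolding continuous_map_def
  proof (intro conjI allI impI)
    fix W assume W: "openin ?X W"
    then have "{x \<in> topspace T. (x, 0) \<in> W} = {x. (x, 0) \<in> W}"
      using openin_subset by fastforce
    then show "openin T {x \<in> topspace T. (x, 0) \<in> W}"
      using W by (simp add: openin_cloud_extension)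
  qed auto
  show "closed_map T ?X (\<lambda>p. (p, 0))"
    unfolding closed_map_def
  proof (intro allI impI)
    fix C assume C: "closedin T C"
    let ?W = "topspace T \<times> UNIV - (\<lambda>p. (p, 0)) ` C"
    have "{p. (p, 0) \<in> ?W} = topspace T - C"
      by auto
    moreover have "countable {t. (p, t) \<notin> ?W}" if "(p, 0) \<in> ?W" for p
      by (rule countable_subset[of _ "{0}"]) (use that in auto)
    moreover have "openin T (topspace T - C)"
      using C by blast
    ultimately have "openin ?X ?W"
      unfolding openin_cloud_extension by (metis Diff_subset)
    moreover have "(\<lambda>p. (p, 0)) ` C \<subseteq> topspace ?X"
      using closedin_subset[OF C] by auto
    ultimately show "closedin ?X ((\<lambda>p. (p, 0)) ` C)"
      by (simp add: closedin_def)
  qed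
  show "inj_on (\<lambda>p. (p, 0::real)) (topspace T)"
    by (simp add: inj_on_def)
qed

section \<open>A Hausdorff weak P-space that is neither regular nor weakly Volterra\<close>

definition strip :: "real set \<Rightarrow> (real \<times> real) topology" where
  "strip C = top_of_set (C \<times> UNIV)"

lemma topspace_strip [simp]: "topspace (strip C) = C \<times> UNIV"
  by (simp add: strip_def)

lemma Hausdorff_space_strip: "Hausdorff_space (strip C)"
  unfolding strip_def by (simp add: Hausdorff_space_subtopology)

lemma openin_strip_contains_box:
  assumes "openin (strip C) U" "U \<noteq> {}"
  obtains V a b where "open V" "V \<inter> C \<noteq> {}" "a < b" "(V \<inter> C) \<times> {a<..<b} \<subseteq> U"
proof -
  obtain x y where xy: "(x, y) \<in> U" using assms(2) by auto
  obtain W where W: "open W" "U = C \<times> UNIV \<inter> W"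
    using assms(1) unfolding strip_def openin_open by blast
  obtain V V' where V: "open V" "open V'" "(x, y) \<in> V \<times> V'" "V \<times> V' \<subseteq> W"
    using open_prod_elim[OF W(1)] xy W(2) by (metis Int_iff)
  then obtain e where "e > 0" "ball y e \<subseteq> V'"
    by (meson mem_Sigma_iff open_contains_ball)
  then have "V \<inter> C \<noteq> {}" "y - e < y + e" "(V \<inter> C) \<times> {y - e<..<y + e} \<subseteq> U"
    using xy V W by (auto simp: ball_eq_greaterThanLessThan)
  then show ?thesis using that V(1) by blast
qed

text \<open>An open set of the strip contains boxes whose vertical side is a nondegenerate interval, and
  density puts one whole interval over a point of \<open>A\<close>.\<close>

lemma uncountable_strip_Int_open:
  assumes "A \<subseteq> C" and dense: "\<And>V. open V \<Longrightarrow> V \<noteq> {} \<Longrightarrow> A \<inter> V \<noteq> {}"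
    and U: "openin (strip C) U" "U \<noteq> {}"
  shows "uncountable ((A \<times> UNIV) \<inter> U)"
proof -
  obtain V a b where V: "open V" "V \<inter> C \<noteq> {}" "a < b" "(V \<inter> C) \<times> {a<..<b} \<subseteq> U"
    using openin_strip_contains_box[OF U] .
  then obtain x where x: "x \<in> A" "x \<in> V" using dense[of V] by blast
  then have "{a<..<b} \<subseteq> snd ` ((A \<times> UNIV) \<inter> U)"
    using V(4) assms(1) by force
  then show ?thesis
    using V(3) by (meson countable_image countable_subset uncountable_open_interval)
qed

text \<open>The complement of \<open>A \<times> \<real>\<close> consists of the countably many closed lines over \<open>B\<close>.\<close>

lemma gdelta_in_strip:
  assumes "countable B" "A \<inter> B = {}"
  shows "gdelta_in (cocountable_refinement (strip (A \<union> B))) (A \<times> UNIV)"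
proof -
  let ?T = "strip (A \<union> B)"
  have "closedin (cocountable_refinement ?T) ({b} \<times> UNIV)" if "b \<in> B" for b
  proof -
    have "closed ({b} \<times> (UNIV::real set))"
      by (simp add: closed_Times)
    moreover have "{b} \<times> UNIV = (A \<union> B) \<times> UNIV \<inter> {b} \<times> (UNIV::real set)"
      using that by auto
    ultimately have "closedin ?T ({b} \<times> UNIV)"
      unfolding strip_def closedin_closed by metis
    then show ?thesis
      by (simp add: closedin_def openin_imp_openin_cocountable_refinement)
  qed
  then have "fsigma_in (cocountable_refinement ?T) (\<Union>b\<in>B. {b} \<times> UNIV)"
    using assms(1) by (intro fsigma_in_Union) (auto intro: closed_imp_fsigma_in)
  moreover have "topspace (cocountable_refinement ?T) - A \<times> UNIV = (\<Union>b\<in>B. {b} \<times> UNIV)"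
    using assms(2) by auto
  ultimately show ?thesis
    unfolding gdelta_in_fsigma_in by auto
qed

lemma disjoint_countable_dense_sets:
  obtains A B :: "real set" where "countable A" "countable B" "A \<inter> B = {}"
    "\<And>V. open V \<Longrightarrow> V \<noteq> {} \<Longrightarrow> A \<inter> V \<noteq> {}" "\<And>V. open V \<Longrightarrow> V \<noteq> {} \<Longrightarrow> B \<inter> V \<noteq> {}"
proof -
  obtain s :: real where s: "s \<notin> \<rat>"
    by (metis UNIV_I countable_rat countable_subset subsetI uncountable_UNIV_real)
  have dense: "(+) c ` \<rat> \<inter> V \<noteq> {}" if V: "open V" "V \<noteq> {}" for c and V :: "real set"
  proof -
    obtain x e where "e > 0" "ball x e \<subseteq> V"
      using V by (metis all_not_in_conv open_contains_ball)
    moreover obtain q where "q \<in> \<rat>" "x - c < q" "q < x - c + e"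
      using Rats_dense_in_real[of "x - c" "x - c + e"] \<open>e > 0\<close> by auto
    ultimately have "c + q \<in> V"
      by (auto simp: ball_eq_greaterThanLessThan)
    then show ?thesis using \<open>q \<in> \<rat>\<close> by blast
  qed
  have "\<rat> \<inter> (+) s ` \<rat> = {}"
  proof -
    have False if "s + q \<in> \<rat>" "q \<in> \<rat>" for q
      using Rats_diff[OF that] s by simp
    then show ?thesis by blast
  qed
  then show ?thesis
    using that[of \<rat> "(+) s ` \<rat>"] dense[of _ 0] dense[of _ s] by (simp add: countable_rat)
qed

lemma exists_nonregular_non_weakly_Volterra_weak_P_space:
  obtains T :: "(real \<times> real) topology" where
    "topspace T \<noteq> {}" "Hausdorff_space T" "weak_P_space T"
    "\<not> regular_space T" "\<not> weakly_Volterra_space T"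
proof -
  obtain A B :: "real set" where AB: "countable A" "countable B" "A \<inter> B = {}"
    and dense: "\<And>V. open V \<Longrightarrow> V \<noteq> {} \<Longrightarrow> A \<inter> V \<noteq> {}"
      "\<And>V. open V \<Longrightarrow> V \<noteq> {} \<Longrightarrow> B \<inter> V \<noteq> {}"
    by (rule disjoint_countable_dense_sets) blast
  let ?S = "strip (A \<union> B)"
  let ?T = "cocountable_refinement ?S"
  have ne: "A \<noteq> {}" using dense(1)[of UNIV] by auto
  have unc: "uncountable ((A \<times> UNIV) \<inter> U)" "uncountable ((B \<times> UNIV) \<inter> U)"
    if "openin ?S U" "U \<noteq> {}" for U
    using uncountable_strip_Int_open[of A "A \<union> B" U] uncountable_strip_Int_open[of B "A \<union> B" U]
      dense that by auto
  have "dense_in ?S (A \<times> \<rat>)"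
    unfolding dense_in_iff_meets_open
  proof (intro conjI allI impI)
    fix U assume U: "openin ?S U \<and> U \<noteq> {}"
    obtain V a b where V: "open V" "V \<inter> (A \<union> B) \<noteq> {}" "a < b"
      "(V \<inter> (A \<union> B)) \<times> {a<..<b} \<subseteq> U"
      using openin_strip_contains_box[of "A \<union> B" U] U by blast
    obtain x where "x \<in> A" "x \<in> V" using dense(1)[of V] V by blast
    moreover obtain q where "q \<in> \<rat>" "a < q" "q < b"
      using Rats_dense_in_real V(3) by blast
    ultimately have "(x, q) \<in> A \<times> \<rat> \<inter> U"
      using V(4) by auto
    then show "A \<times> \<rat> \<inter> U \<noteq> {}" by blast
  qed auto
  moreover have "countable (A \<times> (\<rat> :: real set))"
    using AB(1) countable_rat by blast
  moreover have "uncountable U" if "openin ?S U" "U \<noteq> {}" for U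
    using unc(1)[OF that] countable_subset by blast
  ultimately have "\<not> regular_space ?T"
    using ne by (intro not_regular_space_cocountable_refinement) auto
  moreover have "dense_in ?T (A \<times> UNIV)" "dense_in ?T (B \<times> UNIV)"
    using unc by (auto intro!: dense_in_cocountable_refinement)
  then have "\<not> weakly_Volterra_space ?T"
    using gdelta_in_strip[of B A] gdelta_in_strip[of A B] AB
    unfolding weakly_Volterra_space_def by (auto simp: Un_commute Int_commute)
  ultimately show ?thesis
    using that[of ?T] ne Hausdorff_space_cocountable_refinement[OF Hausdorff_space_strip]
      weak_P_space_cocountable_refinement by auto
qed

section \<open>Transfer to the real numbers\<close>

lemma exists_bij_real_triple: "\<exists>g :: real \<Rightarrow> (real \<times> real) \<times> real. bij g"
proof -
  have "(card_of (UNIV \<times> UNIV :: (real \<times> real) set), card_of (UNIV :: real set)) \<in> ordIso"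
    by (intro card_of_Times_same_infinite) (simp add: infinite_UNIV_char_0)
  then obtain f :: "real \<times> real \<Rightarrow> real" where "bij f"
    unfolding card_of_ordIso[symmetric] by auto
  then have "bij (inv f)"
    by (rule bij_imp_bij_inv)
  moreover from this have "bij (map_prod (inv f) (id :: real \<Rightarrow> real))"
    unfolding bij_def by (metis inj_on_id map_prod_surj prod.inj_map surj_id)
  ultimately have "bij (map_prod (inv f) (id :: real \<Rightarrow> real) \<circ> inv f)"
    using bij_comp by blast
  then show ?thesis by blast
qed

theorem mainTheorem5:
  shows "\<exists>X :: real topology.
           topspace X \<noteq> {} \<and>
           Hausdorff_space X \<and>
           \<not> regular_space X \<and>
           Baire_space X \<and>
           pseudo_P_space X \<and>
           \<not> hereditarily_weakly_Volterra_space X"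
proof -
  obtain T :: "(real \<times> real) topology" where
    T: "topspace T \<noteq> {}" "Hausdorff_space T" "weak_P_space T"
      "\<not> regular_space T" "\<not> weakly_Volterra_space T"
    by (rule exists_nonregular_non_weakly_Volterra_weak_P_space)
  let ?E = "cloud_extension T"
  obtain g :: "real \<Rightarrow> (real \<times> real) \<times> real" where "bij g"
    using exists_bij_real_triple by blast
  define X where "X = pullback_topology UNIV g ?E"
  have g: "homeomorphic_map X ?E g"
    unfolding X_def by (rule homeomorphic_map_pullback[OF \<open>bij g\<close>])
  then obtain h where h: "homeomorphic_map ?E X h"
    by (meson homeomorphic_map_maps homeomorphic_maps_sym)
  define e where "e = h \<circ> (\<lambda>p. (p, 0))"
  have "embedding_map T X e"
    unfolding e_def using embedding_map_cloud_extension h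
    by (metis embedding_map_compose homeomorphic_map_def injective_open_imp_embedding_map
        homeomorphic_eq_everything_map)
  then have e: "homeomorphic_map T (subtopology X (e ` topspace T)) e"
    by (simp add: embedding_map_def)
  have "e ` topspace T \<subseteq> topspace X"
    using homeomorphic_imp_surjective_map[OF e] by (metis inf.cobounded1 topspace_subtopology)
  moreover have "\<not> weakly_Volterra_space (subtopology X (e ` topspace T))"
    using homeomorphic_map_weakly_Volterra_space[OF e] T(5) by blast
  ultimately have "\<not> hereditarily_weakly_Volterra_space X"
    unfolding hereditarily_weakly_Volterra_space_def using T(1) by blast
  moreover have "\<not> regular_space X"
    using T(4) e homeomorphic_regular_space homeomorphic_map_imp_homeomorphic_space
      regular_space_subtopology by blast
  moreover have "Hausdorff_space X"
    using Hausdorff_space_cloud_extension[OF T(2)] homeomorphic_Hausdorff_space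
      homeomorphic_map_imp_homeomorphic_space[OF g] by blast
  moreover have "topspace X \<noteq> {}"
    using h T(1) by (auto simp: homeomorphic_eq_everything_map)
  moreover have "Baire_space X"
    by (rule homeomorphic_map_Baire_space[OF h Baire_space_cloud_extension])
  moreover have "pseudo_P_space X"
    using homeomorphic_map_pseudo_P_space[OF h] almost_P_space_cloud_extension
      weak_P_space_cloud_extension[OF T(3)] unfolding pseudo_P_space_def by blast
  ultimately show ?thesis by blast
qed

end
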